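(* (Substitution Theorem) Let $G\in\mathbb{GS}$, let $A$ be a Left option of $G$ and let $B=\langle\emptyset^\ell\mid B^{\mathcal R}\rangle$ be a left-atomic Right option of $A$ with $B\preccurlyeq G$ (so $A$ is atomic-reversible through $B$). Suppose that $\underline{Ls}(G)=\underline{Rs}(A)>\underline{Rs}(G^L)$ for all $G^L\in G^{\mathcal L}\setminus\{A\}$. (1) There exists a smallest nonnegative integer $n$ such that $G\succcurlyeq\ell-\widehat n$, and for this $n$, $G\sim\langle\ell-\widehat{n+1},\,G^{\mathcal L}\setminus\{A\}\mid G^{\mathcal R}\rangle$. (2) If $A$ is the only Left option of $G$ and $\langle\emptyset^\ell\mid G^{\mathcal R}\rangle\in\mathbb{GS}$, then $G\sim\langle\emptyset^\ell\mid G^{\mathcal R}\rangle$.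
   Context: A scoring game is written $G=\langle G^{\mathcal L}\mid G^{\mathcal R}\rangle$, where each of $G^{\mathcal L}$ (Left options) and $G^{\mathcal R}$ (Right options) is either a finite nonempty set of scoring games or an atom $\emptyset^{s}$, $s\in\mathbb R$ (the player to move on that side cannot move and the game ends with score $s$); game trees are finite. An atom occurring in $G$ is an atom of $G$ or of any follower of $G$. $G$ is guaranteed if for every follower $K$ of $G$: if $K^{\mathcal L}=\emptyset^\ell$ then $\ell\le s$ for every atom $\emptyset^s$ occurring in $K$, and if $K^{\mathcal R}=\emptyset^r$ then $s\le r$ for every atom $\emptyset^s$ occurring in $K$; $\mathbb{GS}$ is the class of guaranteed games. Disjunctive sum $G+H$: Left options are $G^L+H$ and $G+H^L$, except if both are left-atomic with atoms $\emptyset^{\ell_1},\emptyset^{\ell_2}$, then $(G+H)^{\mathcal L}=\emptyset^{\ell_1+\ell_2}$; Right symmetric. Stops: $Ls(G)=\ell$ if $G^{\mathcal L}=\emptyset^\ell$, otherwise $\max_{G^L}Rs(G^L)$; $Rs(G)=r$ if $G^{\mathcal R}=\emptyset^r$, otherwise $\min_{G^R}Ls(G^R)$. $G\succcurlyeq H$ iff $Ls(G+X)\ge Ls(H+X)$ and $Rs(G+X)\ge Rs(H+X)$ for all $X\in\mathbb{GS}$; $B\preccurlyeq G$ means $G\succcurlyeq B$; $G\sim H$ iff both hold. A real number $x$ denotes $\langle\emptyset^x\mid\emptyset^x\rangle$. Conjugate: $\overleftrightarrow{G}=\langle\overleftrightarrow{G^{\mathcal R}}\mid\overleftrightarrow{G^{\mathcal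 L}}\rangle$ (atom $\emptyset^s$ becomes $\emptyset^{-s}$). Waiting moves: $\widehat 0=\langle\emptyset^0\mid\emptyset^0\rangle$, $\widehat{k+1}=\langle\widehat k\mid\emptyset^0\rangle$, $-\widehat k=\overleftrightarrow{\widehat k}$; $\ell-\widehat k$ is the disjunctive sum of $\ell$ and $-\widehat k$. Right-pass-allowed stops: $\underline{Ls}(G)=\min_{k\ge0}Ls(G-\widehat k)$, $\underline{Rs}(G)=\min_{k\ge0}Rs(G-\widehat k)$. *)

theory Defs
  imports Complex_Main "HOL-Library.FSet"
begin

(* Nonemptiness of the option sets is not part of the type; it is imposed
   hereditarily by scoring_game below. *)
datatype 'a side = Atom real | Opts "'a fset"

datatype game = Game (lside: "game side") (rside: "game side")

abbreviation left_opts :: "game \<Rightarrow> game set" where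
  "left_opts G \<equiv> set_side (lside G)"

abbreviation right_opts :: "game \<Rightarrow> game set" where
  "right_opts G \<equiv> set_side (rside G)"

lemma left_option_size: "H \<in> left_opts G \<Longrightarrow> size H < size G"
proof (cases G)
  case (Game L R)
  assume "H \<in> left_opts G"
  then obtain gs where gs: "L = Opts gs" "H \<in> fset gs" using Game by (cases L) auto
  then have "Suc (size H) \<le> (\<Sum>x\<in>fset gs. Suc (size x))"
    using member_le_sum[of H "fset gs" "\<lambda>x. Suc (size x)"] by simp
  then show ?thesis using Game gs by simp
qed

lemma right_option_size: "H \<in> right_opts G \<Longrightarrow> size H < size G"
proof (cases G)
  case (Game L R)
  assume "H \<in> right_opts G"
  then obtain gs where gs: "R = Opts gs" "H \<in> fset gs" using Game by (cases R) auto
  then have "Suc (size H) \<le> (\<Sum>x\<in>fset gs. Suc (size x))"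
    using member_le_sum[of H "fset gs" "\<lambda>x. Suc (size x)"] by simp
  then show ?thesis using Game gs by simp
qed

lemma Opts_size:
  "\<lbrakk>lside G = Opts gs; H |\<in>| gs\<rbrakk> \<Longrightarrow> size H < size G"
  "\<lbrakk>rside G = Opts gs; H |\<in>| gs\<rbrakk> \<Longrightarrow> size H < size G"
  using left_option_size[of H G] right_option_size[of H G] by auto

(* The followers of G include G itself. *)
inductive_set followers :: "game \<Rightarrow> game set" for G :: game where
  self: "G \<in> followers G"
| left: "\<lbrakk>K \<in> followers G; H \<in> left_opts K\<rbrakk> \<Longrightarrow> H \<in> followers G"
| right: "\<lbrakk>K \<in> followers G; H \<in> right_opts K\<rbrakk> \<Longrightarrow> H \<in> followers G"

definition atoms :: "game \<Rightarrow> real set" where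
  "atoms G = {s. \<exists>K\<in>followers G. lside K = Atom s \<or> rside K = Atom s}"

definition scoring_game :: "game \<Rightarrow> bool" where
  "scoring_game G \<longleftrightarrow>
     (\<forall>K\<in>followers G. lside K \<noteq> Opts {||} \<and> rside K \<noteq> Opts {||})"

definition GS :: "game set" where
  "GS = {G. scoring_game G \<and>
     (\<forall>K\<in>followers G.
        (\<forall>l. lside K = Atom l \<longrightarrow> (\<forall>s\<in>atoms K. l \<le> s)) \<and>
        (\<forall>r. rside K = Atom r \<longrightarrow> (\<forall>s\<in>atoms K. s \<le> r)))}"

function gsum :: "game \<Rightarrow> game \<Rightarrow> game" (infixl "\<oplus>" 65) where
  "G \<oplus> H = Game
     (case lside G of
        Atom a \<Rightarrow> (case lside H of
            Atom b \<Rightarrow> Atom (a + b)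
          | Opts hs \<Rightarrow> Opts ((\<lambda>h. G \<oplus> h) |`| hs))
      | Opts gs \<Rightarrow> (case lside H of
            Atom b \<Rightarrow> Opts ((\<lambda>g. g \<oplus> H) |`| gs)
          | Opts hs \<Rightarrow> Opts ((\<lambda>g. g \<oplus> H) |`| gs |\<union>| (\<lambda>h. G \<oplus> h) |`| hs)))
     (case rside G of
        Atom a \<Rightarrow> (case rside H of
            Atom b \<Rightarrow> Atom (a + b)
          | Opts hs \<Rightarrow> Opts ((\<lambda>h. G \<oplus> h) |`| hs))
      | Opts gs \<Rightarrow> (case rside H of
            Atom b \<Rightarrow> Opts ((\<lambda>g. g \<oplus> H) |`| gs)
          | Opts hs \<Rightarrow> Opts ((\<lambda>g. g \<oplus> H) |`| gs |\<union>| (\<lambda>h. G \<oplus> h) |`| hs)))"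
  by pat_completeness auto
termination
  by (relation "measure (\<lambda>(G, H). size G + size H)") (auto dest: Opts_size)

declare gsum.simps [simp del]

function Ls :: "game \<Rightarrow> real" and Rs :: "game \<Rightarrow> real" where
  "Ls G = (case lside G of Atom l \<Rightarrow> l | Opts gs \<Rightarrow> Max (Rs ` fset gs))"
| "Rs G = (case rside G of Atom r \<Rightarrow> r | Opts gs \<Rightarrow> Min (Ls ` fset gs))"
  by pat_completeness auto
termination
  by (relation "measure (case_sum size size)") (auto dest: Opts_size)

declare Ls.simps [simp del] Rs.simps [simp del]

definition game_ge :: "game \<Rightarrow> game \<Rightarrow> bool" (infix "\<succeq>" 50) where
  "G \<succeq> H \<longleftrightarrow> (\<forall>X\<in>GS. Ls (G \<oplus> X) \<ge> Ls (H \<oplus> X) \<and> Rs (G \<oplus> X) \<ge> Rs (H \<oplus> X))"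

abbreviation game_le :: "game \<Rightarrow> game \<Rightarrow> bool" (infix "\<preceq>" 50) where
  "H \<preceq> G \<equiv> G \<succeq> H"

definition game_equiv :: "game \<Rightarrow> game \<Rightarrow> bool" (infix "\<sim>" 50) where
  "G \<sim> H \<longleftrightarrow> G \<succeq> H \<and> H \<succeq> G"

definition number :: "real \<Rightarrow> game" where
  "number x = Game (Atom x) (Atom x)"

primrec negate_atom :: "'a side \<Rightarrow> 'a side" where
  "negate_atom (Atom s) = Atom (- s)"
| "negate_atom (Opts gs) = Opts gs"

primrec conjugate :: "game \<Rightarrow> game" where
  "conjugate (Game L R) =
     Game (negate_atom (map_side conjugate R)) (negate_atom (map_side conjugate L))"

primrec waiting :: "nat \<Rightarrow> game" where
  "waiting 0 = Game (Atom 0) (Atom 0)"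
| "waiting (Suc k) = Game (Opts {|waiting k|}) (Atom 0)"

definition sub_waiting :: "game \<Rightarrow> nat \<Rightarrow> game" where
  "sub_waiting G k = G \<oplus> conjugate (waiting k)"

(* Min is a genuine minimum here: for every scoring game G the values
   Ls (sub_waiting G k) and Rs (sub_waiting G k) lie in the finite set atoms G;
   see finite_range_stops below. *)
definition Ls_pass :: "game \<Rightarrow> real" where
  "Ls_pass G = Min (range (\<lambda>k. Ls (sub_waiting G k)))"

definition Rs_pass :: "game \<Rightarrow> real" where
  "Rs_pass G = Min (range (\<lambda>k. Rs (sub_waiting G k)))"

lemma followers_trans: "\<lbrakk>H \<in> followers K; K \<in> followers G\<rbrakk> \<Longrightarrow> H \<in> followers G"
  by (induction rule: followers.induct) (auto intro: followers.intros)

lemma option_follower: "H \<in> left_opts G \<union> right_opts G \<Longrightarrow> H \<in> followers G"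
  using followers.left[OF followers.self] followers.right[OF followers.self] by blast

lemma atoms_option:
  "H \<in> left_opts G \<union> right_opts G \<Longrightarrow> atoms H \<subseteq> atoms G"
  unfolding atoms_def using option_follower[of H G] followers_trans by blast

lemma scoring_game_option:
  "\<lbrakk>scoring_game G; H \<in> left_opts G \<union> right_opts G\<rbrakk> \<Longrightarrow> scoring_game H"
  unfolding scoring_game_def using option_follower[of H G] followers_trans by blast

lemma followers_unfold:
  "followers G = insert G (\<Union>H\<in>left_opts G \<union> right_opts G. followers H)"
proof (intro equalityI subsetI)
  fix K assume "K \<in> followers G"
  then show "K \<in> insert G (\<Union>H\<in>left_opts G \<union> right_opts G. followers H)"
  proof induction
    case self
    show ?case by blast
  next
    case (left K H)
    then show ?case using followers.self[of H] followers.left[of K _ H] by blast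
  next
    case (right K H)
    then show ?case using followers.self[of H] followers.right[of K _ H] by blast
  qed
next
  fix K assume "K \<in> insert G (\<Union>H\<in>left_opts G \<union> right_opts G. followers H)"
  then consider "K = G" | H where "H \<in> left_opts G \<union> right_opts G" "K \<in> followers H"
    by blast
  then show "K \<in> followers G"
    using followers.self followers_trans[OF _ option_follower] by cases simp_all
qed

lemma finite_set_side: "finite (set_side S)"
  by (cases S) auto

lemma finite_followers: "finite (followers G)"
proof (induction "size G" arbitrary: G rule: less_induct)
  case less
  then show ?case
    by (subst followers_unfold)
       (auto simp: finite_set_side dest: left_option_size right_option_size)
qed

lemma finite_atoms: "finite (atoms G)"
proof (rule finite_subset)
  let ?f = "\<lambda>S :: game side. case S of Atom s \<Rightarrow> s | Opts _ \<Rightarrow> 0"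
  show "atoms G \<subseteq> (?f \<circ> lside) ` followers G \<union> (?f \<circ> rside) ` followers G"
    by (force simp: atoms_def image_iff)
qed (simp add: finite_followers)

lemma conjugate_waiting:
  "lside (conjugate (waiting k)) = Atom 0"
  "rside (conjugate (waiting k)) =
     (case k of 0 \<Rightarrow> Atom 0 | Suc j \<Rightarrow> Opts {|conjugate (waiting j)|})"
  by (cases k; simp)+

lemma sides_sub_waiting:
  "lside (sub_waiting G k) =
     (case lside G of Atom s \<Rightarrow> Atom s | Opts gs \<Rightarrow> Opts ((\<lambda>g. sub_waiting g k) |`| gs))"
  "rside (sub_waiting G 0) =
     (case rside G of Atom s \<Rightarrow> Atom s | Opts gs \<Rightarrow> Opts ((\<lambda>g. sub_waiting g 0) |`| gs))"
  "rside (sub_waiting G (Suc j)) =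
     (case rside G of
        Atom s \<Rightarrow> Opts {|sub_waiting G j|}
      | Opts gs \<Rightarrow> Opts ((\<lambda>g. sub_waiting g (Suc j)) |`| gs |\<union>| {|sub_waiting G j|}))"
  unfolding sub_waiting_def
  by (subst gsum.simps, simp add: conjugate_waiting del: waiting.simps split: side.split)+

lemma stops_sub_waiting_atoms:
  assumes "scoring_game G"
  shows "Ls (sub_waiting G k) \<in> atoms G \<and> Rs (sub_waiting G k) \<in> atoms G"
  using assms
proof (induction "size G + k" arbitrary: G k rule: less_induct)
  case less
  have ne: "lside G \<noteq> Opts {||}" "rside G \<noteq> Opts {||}"
    using less.prems followers.self[of G] by (auto simp: scoring_game_def)
  have L: "Rs (sub_waiting H k) \<in> atoms G" if "H \<in> left_opts G" for H
    using less.hyps[of H k] that left_option_size[OF that] atoms_option[of H G]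
      scoring_game_option[OF less.prems, of H] by auto
  have R: "Ls (sub_waiting H k) \<in> atoms G" if "H \<in> right_opts G" for H
    using less.hyps[of H k] that right_option_size[OF that] atoms_option[of H G]
      scoring_game_option[OF less.prems, of H] by auto
  have W: "Ls (sub_waiting G j) \<in> atoms G" if "k = Suc j" for j
    using less.hyps[of G j] that less.prems by auto
  have "Ls (sub_waiting G k) \<in> atoms G"
  proof (cases "lside G")
    case (Atom s)
    then show ?thesis
      using followers.self[of G]
      by (auto simp: Ls.simps[of "sub_waiting G k"] sides_sub_waiting atoms_def)
  next
    case (Opts gs)
    let ?S = "(\<lambda>H. Rs (sub_waiting H k)) ` fset gs"
    have "Ls (sub_waiting G k) = Max ?S"
      using Opts
      by (simp add: Ls.simps[of "sub_waiting G k"] sides_sub_waiting image_image)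
    moreover have "Max ?S \<in> ?S" using Opts ne by (intro Max_in) auto
    ultimately show ?thesis using L Opts by auto
  qed
  moreover have "Rs (sub_waiting G k) \<in> atoms G"
  proof (cases "rside G")
    case (Atom s)
    then show ?thesis
      using followers.self[of G] W
      by (cases k)
         (auto simp: Rs.simps[of "sub_waiting G _"] sides_sub_waiting atoms_def)
  next
    case (Opts gs)
    let ?S = "(\<lambda>H. Ls (sub_waiting H k)) ` fset gs
                \<union> (case k of 0 \<Rightarrow> {} | Suc j \<Rightarrow> {Ls (sub_waiting G j)})"
    have "Rs (sub_waiting G k) = Min ?S"
      using Opts
      by (cases k)
         (simp_all add: Rs.simps[of "sub_waiting G _"] sides_sub_waiting image_image image_Un)
    moreover have "Min ?S \<in> ?S" using Opts ne by (intro Min_in) (auto split: nat.split)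
    ultimately show ?thesis using R W Opts by (auto split: nat.splits)
  qed
  ultimately show ?case ..
qed

lemma finite_range_stops:
  assumes "scoring_game G"
  shows "finite (range (\<lambda>k. Ls (sub_waiting G k)))" "finite (range (\<lambda>k. Rs (sub_waiting G k)))"
  by (rule finite_subset[OF _ finite_atoms[of G]];
      use stops_sub_waiting_atoms[OF assms] in blast)+

end

theory Submission
  imports Defs
begin

text \<open>
  Two games with the same Right side are compared by induction on the test game \<open>X\<close>, where only
  Left's move has to be examined. Left's move to \<open>A + X\<close> is answered by \<open>B + X\<close>. There Left either
  has no move, which gives \<open>l\<close> plus the atom of \<open>X\<close>, or moves in \<open>X\<close>; since \<open>B \<preceq> G\<close> the latter is no
  better than making the same move in \<open>G + X\<close>. If \<open>X\<close> is left-atomic, guaranteedness bounds all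
  its atoms below by the left one, so \<open>l\<close> minus any number of waiting moves also yields at least
  \<open>l\<close> plus that atom. Conversely, let \<open>n\<close> be such that \<open>l\<close> minus \<open>n\<close> waiting moves is at most \<open>G\<close>.
  Left's new move to \<open>l\<close> minus \<open>n + 1\<close> waiting moves is then reversible: Right answers it with a
  waiting move. Such an \<open>n\<close> exists because every atom of \<open>B\<close> is at least \<open>l\<close>, so that with enough
  waiting moves Right can match any play in \<open>B\<close>.
\<close>

lemma scoring_game_sides:
  assumes "scoring_game G"
  shows "lside G \<noteq> Opts {||}" "rside G \<noteq> Opts {||}"
  using assms followers.self[of G] by (auto simp: scoring_game_def)

lemma GS_scoring_game: "G \<in> GS \<Longrightarrow> scoring_game G"
  by (simp add: GS_def)

lemma GS_sides:
  assumes "G \<in> GS"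
  shows "lside G \<noteq> Opts {||}" "rside G \<noteq> Opts {||}"
  using scoring_game_sides[OF GS_scoring_game[OF assms]] .

lemma GS_option: "\<lbrakk>G \<in> GS; H \<in> left_opts G \<union> right_opts G\<rbrakk> \<Longrightarrow> H \<in> GS"
  using scoring_game_option[of G H] followers_trans[OF _ option_follower[of H G]]
  by (fastforce simp: GS_def)

lemma GS_lside_Atom_le: "\<lbrakk>G \<in> GS; lside G = Atom l; s \<in> atoms G\<rbrakk> \<Longrightarrow> l \<le> s"
  using followers.self[of G] unfolding GS_def by blast

lemma GS_rside_Atom_ge: "\<lbrakk>G \<in> GS; rside G = Atom r; s \<in> atoms G\<rbrakk> \<Longrightarrow> s \<le> r"
  using followers.self[of G] unfolding GS_def by blast

lemma rside_Atom_in_atoms: "rside G = Atom s \<Longrightarrow> s \<in> atoms G"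
  using followers.self[of G] by (auto simp: atoms_def)

lemma game_ge_trans: "\<lbrakk>G \<succeq> H; H \<succeq> K\<rbrakk> \<Longrightarrow> G \<succeq> K"
  unfolding game_ge_def by (meson order_trans)

lemma game_ge_Ls: "\<lbrakk>G \<succeq> H; X \<in> GS\<rbrakk> \<Longrightarrow> Ls (H \<oplus> X) \<le> Ls (G \<oplus> X)"
  by (simp add: game_ge_def)

lemma game_ge_Rs: "\<lbrakk>G \<succeq> H; X \<in> GS\<rbrakk> \<Longrightarrow> Rs (H \<oplus> X) \<le> Rs (G \<oplus> X)"
  by (simp add: game_ge_def)

lemma Rs_left_option_le_Ls: "H \<in> left_opts G \<Longrightarrow> Rs H \<le> Ls G"
  by (cases "lside G") (auto simp: Ls.simps[of G])

lemma Rs_le_Ls_right_option: "H \<in> right_opts G \<Longrightarrow> Rs G \<le> Ls H"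
  by (cases "rside G") (auto simp: Rs.simps[of G])

lemma Ls_leI:
  assumes "lside G \<noteq> Opts {||}"
    and "\<And>a. lside G = Atom a \<Longrightarrow> a \<le> r"
    and "\<And>H. H \<in> left_opts G \<Longrightarrow> Rs H \<le> r"
  shows "Ls G \<le> r"
  using assms by (cases "lside G") (auto simp: Ls.simps[of G] intro!: Max.boundedI)

lemma Rs_geI:
  assumes "rside G \<noteq> Opts {||}"
    and "\<And>a. rside G = Atom a \<Longrightarrow> r \<le> a"
    and "\<And>H. H \<in> right_opts G \<Longrightarrow> r \<le> Ls H"
  shows "r \<le> Rs G"
  using assms by (cases "rside G") (auto simp: Rs.simps[of G] intro!: Min.boundedI)

lemma left_opts_gsum:
  "left_opts (G \<oplus> H) = (\<lambda>g. g \<oplus> H) ` left_opts G \<union> (\<lambda>h. G \<oplus> h) ` left_opts H"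
  by (subst gsum.simps) (auto split: side.split)

lemma right_opts_gsum:
  "right_opts (G \<oplus> H) = (\<lambda>g. g \<oplus> H) ` right_opts G \<union> (\<lambda>h. G \<oplus> h) ` right_opts H"
  by (subst gsum.simps) (auto split: side.split)

lemma lside_gsum_eq_Atom_iff:
  "lside (G \<oplus> H) = Atom s \<longleftrightarrow> (\<exists>a b. lside G = Atom a \<and> lside H = Atom b \<and> s = a + b)"
  by (subst gsum.simps) (auto split: side.split)

lemma rside_gsum_eq_Atom_iff:
  "rside (G \<oplus> H) = Atom s \<longleftrightarrow> (\<exists>a b. rside G = Atom a \<and> rside H = Atom b \<and> s = a + b)"
  by (subst gsum.simps) (auto split: side.split)

lemma lside_gsum_nonempty:
  "\<lbrakk>lside G \<noteq> Opts {||}; lside H \<noteq> Opts {||}\<rbrakk> \<Longrightarrow> lside (G \<oplus> H) \<noteq> Opts {||}"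
  by (subst gsum.simps) (auto split: side.split)

lemma rside_gsum_nonempty:
  "\<lbrakk>rside G \<noteq> Opts {||}; rside H \<noteq> Opts {||}\<rbrakk> \<Longrightarrow> rside (G \<oplus> H) \<noteq> Opts {||}"
  by (subst gsum.simps) (auto split: side.split)

lemma followers_gsumE:
  assumes "M \<in> followers (G \<oplus> H)"
  obtains K L where "M = K \<oplus> L" "K \<in> followers G" "L \<in> followers H"
proof -
  from assms have "\<exists>K\<in>followers G. \<exists>L\<in>followers H. M = K \<oplus> L"
  proof induction
    case self
    show ?case by (blast intro: followers.self)
  next
    case (left M N)
    then obtain K L where "K \<in> followers G" "L \<in> followers H" "N \<in> left_opts (K \<oplus> L)"
      by blast
    then show ?case unfolding left_opts_gsum by (blast intro: followers.left)
  next
    case (right M N)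
    then obtain K L where "K \<in> followers G" "L \<in> followers H" "N \<in> right_opts (K \<oplus> L)"
      by blast
    then show ?case unfolding right_opts_gsum by (blast intro: followers.right)
  qed
  then show ?thesis using that by blast
qed

lemma scoring_game_gsum:
  assumes "scoring_game G" "scoring_game H"
  shows "scoring_game (G \<oplus> H)"
  unfolding scoring_game_def
proof
  fix M assume "M \<in> followers (G \<oplus> H)"
  then obtain K L where "M = K \<oplus> L" "K \<in> followers G" "L \<in> followers H"
    by (rule followers_gsumE)
  then show "lside M \<noteq> Opts {||} \<and> rside M \<noteq> Opts {||}"
    using assms by (simp add: scoring_game_def lside_gsum_nonempty rside_gsum_nonempty)
qed

lemma atoms_gsumE:
  assumes "s \<in> atoms (G \<oplus> H)"
  obtains a b where "s = a + b" "a \<in> atoms G" "b \<in> atoms H"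
proof -
  obtain M where "M \<in> followers (G \<oplus> H)" and s: "lside M = Atom s \<or> rside M = Atom s"
    using assms by (auto simp: atoms_def)
  then obtain K L where KL: "M = K \<oplus> L" "K \<in> followers G" "L \<in> followers H"
    by (elim followers_gsumE)
  with s obtain a b where "s = a + b"
    and "lside K = Atom a \<and> lside L = Atom b \<or> rside K = Atom a \<and> rside L = Atom b"
    by (auto simp: lside_gsum_eq_Atom_iff rside_gsum_eq_Atom_iff)
  then show ?thesis using KL by (intro that[of a b]) (auto simp: atoms_def)
qed

lemma sub_waiting_0: "sub_waiting G 0 = G"
proof (induction "size G" arbitrary: G rule: less_induct)
  case less
  have "sub_waiting H 0 = H" if "H \<in> left_opts G \<union> right_opts G" for H
    using less that left_option_size right_option_size by blast
  then show ?case
    by (intro game.expand)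
      (auto simp: sides_sub_waiting fset_eq_iff image_iff split: side.split)
qed

lemma stops_in_atoms:
  assumes "scoring_game G"
  shows "Ls G \<in> atoms G" "Rs G \<in> atoms G"
  using stops_sub_waiting_atoms[OF assms, of 0] by (simp_all add: sub_waiting_0)

lemma stops_gsum_left_atomic_ge:
  assumes "scoring_game G" "\<forall>s\<in>atoms G. a \<le> s" "X \<in> GS" "lside X = Atom x"
  shows "a + x \<le> Ls (G \<oplus> X)" "a + x \<le> Rs (G \<oplus> X)"
proof -
  have "a + x \<le> s" if "s \<in> atoms (G \<oplus> X)" for s
    using that assms(2) GS_lside_Atom_le[OF assms(3,4)]
    by (elim atoms_gsumE) (auto intro: add_mono)
  then show "a + x \<le> Ls (G \<oplus> X)" "a + x \<le> Rs (G \<oplus> X)"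
    using stops_in_atoms[OF scoring_game_gsum[OF assms(1) GS_scoring_game[OF assms(3)]]] by auto
qed

lemma stops_gsum_right_atomic_le:
  assumes "scoring_game G" "\<forall>s\<in>atoms G. s \<le> a" "X \<in> GS" "rside X = Atom x"
  shows "Ls (G \<oplus> X) \<le> a + x" "Rs (G \<oplus> X) \<le> a + x"
proof -
  have "s \<le> a + x" if "s \<in> atoms (G \<oplus> X)" for s
    using that assms(2) GS_rside_Atom_ge[OF assms(3,4)]
    by (elim atoms_gsumE) (auto intro: add_mono)
  then show "Ls (G \<oplus> X) \<le> a + x" "Rs (G \<oplus> X) \<le> a + x"
    using stops_in_atoms[OF scoring_game_gsum[OF assms(1) GS_scoring_game[OF assms(3)]]] by auto
qed

lemma Ls_gsum_Atom: "\<lbrakk>lside G = Atom a; lside H = Atom b\<rbrakk> \<Longrightarrow> Ls (G \<oplus> H) = a + b"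
  by (subst Ls.simps, subst gsum.simps) simp

lemma Rs_gsum_Atom: "\<lbrakk>rside G = Atom a; rside H = Atom b\<rbrakk> \<Longrightarrow> Rs (G \<oplus> H) = a + b"
  by (subst Rs.simps, subst gsum.simps) simp

lemma Rs_gsum_le_Ls_gsum:
  "g \<in> left_opts G \<Longrightarrow> Rs (g \<oplus> H) \<le> Ls (G \<oplus> H)"
  "h \<in> left_opts H \<Longrightarrow> Rs (G \<oplus> h) \<le> Ls (G \<oplus> H)"
  "g \<in> right_opts G \<Longrightarrow> Rs (G \<oplus> H) \<le> Ls (g \<oplus> H)"
  "h \<in> right_opts H \<Longrightarrow> Rs (G \<oplus> H) \<le> Ls (G \<oplus> h)"
  by (auto intro: Rs_left_option_le_Ls Rs_le_Ls_right_option
      simp: left_opts_gsum right_opts_gsum)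

lemma Ls_gsum_leI:
  assumes "lside G \<noteq> Opts {||}" "lside H \<noteq> Opts {||}"
    and "\<And>a b. \<lbrakk>lside G = Atom a; lside H = Atom b\<rbrakk> \<Longrightarrow> a + b \<le> r"
    and "\<And>g. g \<in> left_opts G \<Longrightarrow> Rs (g \<oplus> H) \<le> r"
    and "\<And>h. h \<in> left_opts H \<Longrightarrow> Rs (G \<oplus> h) \<le> r"
  shows "Ls (G \<oplus> H) \<le> r"
  using assms
  by (intro Ls_leI) (auto simp: lside_gsum_nonempty lside_gsum_eq_Atom_iff left_opts_gsum)

lemma Rs_gsum_geI:
  assumes "rside G \<noteq> Opts {||}" "rside H \<noteq> Opts {||}"
    and "\<And>a b. \<lbrakk>rside G = Atom a; rside H = Atom b\<rbrakk> \<Longrightarrow> r \<le> a + b"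
    and "\<And>g. g \<in> right_opts G \<Longrightarrow> r \<le> Ls (g \<oplus> H)"
    and "\<And>h. h \<in> right_opts H \<Longrightarrow> r \<le> Ls (G \<oplus> h)"
  shows "r \<le> Rs (G \<oplus> H)"
  using assms
  by (intro Rs_geI) (auto simp: rside_gsum_nonempty rside_gsum_eq_Atom_iff right_opts_gsum)

text \<open>
  Moves in the test game \<open>X\<close> are matched by the same moves, so only plays outside \<open>X\<close> and ends of
  the game need to be checked.
\<close>

lemma game_geI:
  assumes nonempty: "lside H \<noteq> Opts {||}" "rside G \<noteq> Opts {||}"
    and left_end: "\<And>X a x. \<lbrakk>X \<in> GS; lside H = Atom a; lside X = Atom x\<rbrakk>
        \<Longrightarrow> a + x \<le> Ls (G \<oplus> X)"
    and left_move: "\<And>X h. \<lbrakk>X \<in> GS; h \<in> left_opts H;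
          \<And>Y. Y \<in> left_opts X \<Longrightarrow> Rs (H \<oplus> Y) \<le> Rs (G \<oplus> Y)\<rbrakk> \<Longrightarrow> Rs (h \<oplus> X) \<le> Ls (G \<oplus> X)"
    and right_end: "\<And>X a x. \<lbrakk>X \<in> GS; rside G = Atom a; rside X = Atom x\<rbrakk>
        \<Longrightarrow> Rs (H \<oplus> X) \<le> a + x"
    and right_move: "\<And>X g. \<lbrakk>X \<in> GS; g \<in> right_opts G;
          \<And>Y. Y \<in> right_opts X \<Longrightarrow> Ls (H \<oplus> Y) \<le> Ls (G \<oplus> Y)\<rbrakk> \<Longrightarrow> Rs (H \<oplus> X) \<le> Ls (g \<oplus> X)"
  shows "G \<succeq> H"
proof -
  have "Ls (H \<oplus> X) \<le> Ls (G \<oplus> X) \<and> Rs (H \<oplus> X) \<le> Rs (G \<oplus> X)" if "X \<in> GS" for X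
    using that
  proof (induction "size X" arbitrary: X rule: less_induct)
    case less
    have left_IH: "Rs (H \<oplus> Y) \<le> Rs (G \<oplus> Y)" if "Y \<in> left_opts X" for Y
      using less that left_option_size GS_option by blast
    have right_IH: "Ls (H \<oplus> Y) \<le> Ls (G \<oplus> Y)" if "Y \<in> right_opts X" for Y
      using less that right_option_size GS_option by blast
    have "Ls (H \<oplus> X) \<le> Ls (G \<oplus> X)"
      using nonempty(1) GS_sides(1)[OF less.prems]
    proof (rule Ls_gsum_leI)
      fix Y assume "Y \<in> left_opts X"
      then show "Rs (H \<oplus> Y) \<le> Ls (G \<oplus> X)"
        using left_IH Rs_gsum_le_Ls_gsum(2) order_trans by blast
    qed (use less.prems left_end left_move left_IH in auto)
    moreover have "Rs (H \<oplus> X) \<le> Rs (G \<oplus> X)"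
      using nonempty(2) GS_sides(2)[OF less.prems]
    proof (rule Rs_gsum_geI)
      fix Y assume "Y \<in> right_opts X"
      then show "Rs (H \<oplus> X) \<le> Ls (G \<oplus> Y)"
        using right_IH Rs_gsum_le_Ls_gsum(4) order_trans by blast
    qed (use less.prems right_end right_move right_IH in auto)
    ultimately show ?case ..
  qed
  then show ?thesis by (simp add: game_ge_def)
qed

lemma game_ge_same_rsideI:
  assumes "rside G = rside H" "rside G \<noteq> Opts {||}" "lside H \<noteq> Opts {||}"
    and left_end: "\<And>X a x. \<lbrakk>X \<in> GS; lside H = Atom a; lside X = Atom x\<rbrakk>
        \<Longrightarrow> a + x \<le> Ls (G \<oplus> X)"
    and left_move: "\<And>X h. \<lbrakk>X \<in> GS; h \<in> left_opts H;
          \<And>Y. Y \<in> left_opts X \<Longrightarrow> Rs (H \<oplus> Y) \<le> Rs (G \<oplus> Y)\<rbrakk> \<Longrightarrow> Rs (h \<oplus> X) \<le> Ls (G \<oplus> X)"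
  shows "G \<succeq> H"
proof (rule game_geI)
  fix X a x assume "rside G = Atom a" "rside X = Atom x"
  then show "Rs (H \<oplus> X) \<le> a + x" using assms(1) by (simp add: Rs_gsum_Atom)
next
  fix X g assume "g \<in> right_opts G"
  then show "Rs (H \<oplus> X) \<le> Ls (g \<oplus> X)" using assms(1) by (simp add: Rs_gsum_le_Ls_gsum(3))
qed (fact assms)+

lemma sides_number_sub_waiting:
  "lside (sub_waiting (number l) n) = Atom l"
  "rside (sub_waiting (number l) n) =
     (case n of 0 \<Rightarrow> Atom l | Suc k \<Rightarrow> Opts {|sub_waiting (number l) k|})"
  by (simp_all add: sides_sub_waiting number_def split: nat.split)

lemma followers_number_sub_waiting:
  "followers (sub_waiting (number l) n) = sub_waiting (number l) ` {..n}"
proof (induction n)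
  case 0
  show ?case by (simp add: followers_unfold[of "sub_waiting _ 0"] sides_number_sub_waiting)
next
  case (Suc n)
  then show ?case
    by (simp add: followers_unfold[of "sub_waiting _ (Suc _)"] sides_number_sub_waiting
        atMost_Suc)
qed

lemma scoring_game_number_sub_waiting: "scoring_game (sub_waiting (number l) n)"
  by (simp add: scoring_game_def followers_number_sub_waiting sides_number_sub_waiting
      split: nat.split)

lemma atoms_number_sub_waiting: "atoms (sub_waiting (number l) n) = {l}"
  by (auto simp: atoms_def followers_number_sub_waiting sides_number_sub_waiting
      split: nat.splits dest: gr0_implies_Suc)

lemma game_ge_number_sub_waiting:
  assumes "scoring_game G" "\<forall>s\<in>atoms G. l \<le> s" "size G \<le> n"
  shows "G \<succeq> sub_waiting (number l) n"
  using assms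
proof (induction n arbitrary: G)
  case 0
  then show ?case by (cases G) simp
next
  case (Suc n)
  let ?W = "sub_waiting (number l)"
  show ?case
  proof (rule game_geI)
    fix X a x assume "X \<in> GS" "lside (?W (Suc n)) = Atom a" "lside X = Atom x"
    then show "a + x \<le> Ls (G \<oplus> X)"
      using stops_gsum_left_atomic_ge(1) Suc.prems by (simp add: sides_number_sub_waiting)
  next
    fix X a x assume "X \<in> GS" "rside G = Atom a" "rside X = Atom x"
    moreover from this have "l \<le> a" using Suc.prems(2) rside_Atom_in_atoms by blast
    ultimately show "Rs (?W (Suc n) \<oplus> X) \<le> a + x"
      by (intro stops_gsum_right_atomic_le)
        (simp_all add: scoring_game_number_sub_waiting atoms_number_sub_waiting)
  next
    fix X g assume "X \<in> GS" "g \<in> right_opts G"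
    have "g \<succeq> ?W n"
      using \<open>g \<in> right_opts G\<close> Suc.prems scoring_game_option atoms_option[of g G]
        right_option_size[of g G]
      by (intro Suc.IH) auto
    have "Rs (?W (Suc n) \<oplus> X) \<le> Ls (?W n \<oplus> X)"
      by (rule Rs_gsum_le_Ls_gsum(3)) (simp add: sides_number_sub_waiting)
    also have "\<dots> \<le> Ls (g \<oplus> X)" using \<open>g \<succeq> ?W n\<close> \<open>X \<in> GS\<close> by (rule game_ge_Ls)
    finally show "Rs (?W (Suc n) \<oplus> X) \<le> Ls (g \<oplus> X)" .
  qed (use scoring_game_sides[OF Suc.prems(1)] in \<open>auto simp: sides_number_sub_waiting\<close>)
qed

lemma Rs_gsum_reversible_le:
  assumes "B \<in> right_opts A" "B \<preceq> G" "X \<in> GS"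
  shows "Rs (A \<oplus> X) \<le> Ls (G \<oplus> X)"
  using Rs_gsum_le_Ls_gsum(3)[OF assms(1)] game_ge_Ls[OF assms(2,3)] by (rule order_trans)

lemma game_ge_reversible_left_opts:
  assumes "rside G \<noteq> Opts {||}" "L \<noteq> {||}"
    and "\<And>h. h |\<in>| L \<Longrightarrow> h \<in> left_opts G \<or> (\<exists>k\<in>right_opts h. k \<preceq> G)"
  shows "G \<succeq> Game (Opts L) (rside G)"
proof (rule game_ge_same_rsideI)
  fix X h assume "X \<in> GS" "h \<in> left_opts (Game (Opts L) (rside G))"
  then consider "h \<in> left_opts G" | k where "k \<in> right_opts h" "k \<preceq> G"
    using assms(3)[of h] by auto
  then show "Rs (h \<oplus> X) \<le> Ls (G \<oplus> X)"
    by cases (use Rs_gsum_le_Ls_gsum(1) Rs_gsum_reversible_le \<open>X \<in> GS\<close> in auto)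
qed (use assms in simp_all)

lemma game_ge_Atom_left:
  assumes "rside G \<noteq> Opts {||}" "lside B = Atom l" "B \<preceq> G"
  shows "G \<succeq> Game (Atom l) (rside G)"
proof (rule game_ge_same_rsideI)
  fix X a x assume "X \<in> GS" "lside (Game (Atom l) (rside G)) = Atom a" "lside X = Atom x"
  then show "a + x \<le> Ls (G \<oplus> X)"
    using game_ge_Ls[OF assms(3)] Ls_gsum_Atom[OF assms(2)] by fastforce
qed (use assms(1) in simp_all)

definition atomic_reversible_through :: "game \<Rightarrow> game \<Rightarrow> game \<Rightarrow> real \<Rightarrow> bool" where
  "atomic_reversible_through G A B l \<longleftrightarrow>
     A \<in> left_opts G \<and> B \<in> right_opts A \<and> lside B = Atom l \<and> B \<preceq> G"

lemma Ls_gsum_left_atomic_le: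
  assumes B: "lside B = Atom l" "B \<preceq> G" and X: "X \<in> GS"
    and options_le: "\<And>Y. Y \<in> left_opts X \<Longrightarrow> Rs (G \<oplus> Y) \<le> Rs (H \<oplus> Y)"
    and left_end: "\<And>x. lside X = Atom x \<Longrightarrow> l + x \<le> Ls (H \<oplus> X)"
  shows "Ls (B \<oplus> X) \<le> Ls (H \<oplus> X)"
proof (rule Ls_gsum_leI)
  fix Y assume Y: "Y \<in> left_opts X"
  then have "Y \<in> GS" using GS_option[OF X] by blast
  with B(2) have "Rs (B \<oplus> Y) \<le> Rs (G \<oplus> Y)" by (rule game_ge_Rs)
  also have "\<dots> \<le> Rs (H \<oplus> Y)" using Y by (rule options_le)
  also have "\<dots> \<le> Ls (H \<oplus> X)" using Y by (rule Rs_gsum_le_Ls_gsum(2))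
  finally show "Rs (B \<oplus> Y) \<le> Ls (H \<oplus> X)" .
qed (use B(1) GS_sides(1)[OF X] left_end in auto)

lemma game_ge_bypass_atomic_reversible:
  assumes A: "atomic_reversible_through G A B l"
    and H: "rside H = rside G" "rside G \<noteq> Opts {||}" "left_opts G - {A} \<subseteq> left_opts H"
    and left_end: "\<And>X x. \<lbrakk>X \<in> GS; lside X = Atom x\<rbrakk> \<Longrightarrow> l + x \<le> Ls (H \<oplus> X)"
  shows "H \<succeq> G"
proof (rule game_ge_same_rsideI)
  fix X g
  assume X: "X \<in> GS" and g: "g \<in> left_opts G"
    and left_IH: "\<And>Y. Y \<in> left_opts X \<Longrightarrow> Rs (G \<oplus> Y) \<le> Rs (H \<oplus> Y)"
  show "Rs (g \<oplus> X) \<le> Ls (H \<oplus> X)"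
  proof (cases "g = A")
    case True
    then have "Rs (g \<oplus> X) \<le> Ls (B \<oplus> X)"
      using A by (simp add: atomic_reversible_through_def Rs_gsum_le_Ls_gsum(3))
    also have "\<dots> \<le> Ls (H \<oplus> X)"
      using A X left_IH left_end[OF X]
      by (intro Ls_gsum_left_atomic_le[of B l G]) (simp_all add: atomic_reversible_through_def)
    finally show ?thesis .
  next
    case False
    then show ?thesis using g H(3) by (intro Rs_gsum_le_Ls_gsum(1)) blast
  qed
qed (use A H in \<open>auto simp: atomic_reversible_through_def\<close>)

lemma game_equiv_substitute_atomic_reversible:
  assumes A: "atomic_reversible_through G A B l"
    and G: "lside G = Opts GL" "rside G \<noteq> Opts {||}"
    and n: "G \<succeq> sub_waiting (number l) n"
  shows "G \<sim> Game (Opts (finsert (sub_waiting (number l) (n + 1)) (GL |-| {|A|}))) (rside G)"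
    (is "_ \<sim> ?H")
proof -
  let ?W = "sub_waiting (number l)"
  have "G \<succeq> ?H"
    using n G by (intro game_ge_reversible_left_opts) (auto simp: sides_number_sub_waiting)
  moreover have "?H \<succeq> G"
  proof (rule game_ge_bypass_atomic_reversible[OF A])
    fix X x assume "X \<in> GS" "lside X = Atom x"
    then have "l + x \<le> Rs (?W (n + 1) \<oplus> X)"
      by (intro stops_gsum_left_atomic_ge)
        (simp_all add: scoring_game_number_sub_waiting atoms_number_sub_waiting)
    also have "\<dots> \<le> Ls (?H \<oplus> X)" by (rule Rs_gsum_le_Ls_gsum(1)) simp
    finally show "l + x \<le> Ls (?H \<oplus> X)" .
  qed (use G in auto)
  ultimately show ?thesis by (simp add: game_equiv_def)
qed

lemma game_equiv_substitute_sole_atomic_reversible: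
  assumes A: "atomic_reversible_through G A B l"
    and G: "left_opts G = {A}" "rside G \<noteq> Opts {||}"
  shows "G \<sim> Game (Atom l) (rside G)"
proof -
  have "Game (Atom l) (rside G) \<succeq> G"
    using G by (intro game_ge_bypass_atomic_reversible[OF A]) (auto simp: Ls_gsum_Atom)
  moreover have "G \<succeq> Game (Atom l) (rside G)"
    using A G(2) game_ge_Atom_left by (auto simp: atomic_reversible_through_def)
  ultimately show ?thesis by (simp add: game_equiv_def)
qed

theorem theorem33:
  fixes G A B :: game and GL :: "game fset" and l :: real
  assumes "G \<in> GS"
    and "lside G = Opts GL" and "A |\<in>| GL"
    and "B \<in> right_opts A" and "lside B = Atom l"
    and "B \<preceq> G"
    and "Ls_pass G = Rs_pass A"
    and "\<forall>C. C |\<in>| GL |-| {|A|} \<longrightarrow> Rs_pass A > Rs_pass C"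
  shows "(\<exists>n. G \<succeq> sub_waiting (number l) n
            \<and> (\<forall>m. G \<succeq> sub_waiting (number l) m \<longrightarrow> n \<le> m)
            \<and> G \<sim> Game (Opts (finsert (sub_waiting (number l) (n + 1)) (GL |-| {|A|}))) (rside G))
       \<and> (GL = {|A|} \<and> Game (Atom l) (rside G) \<in> GS
            \<longrightarrow> G \<sim> Game (Atom l) (rside G))"
proof -
  have A: "atomic_reversible_through G A B l"
    using assms(2-6) by (simp add: atomic_reversible_through_def)
  note right_nonempty = GS_sides(2)[OF assms(1)]
  have "B \<in> GS" using GS_option[of G A] GS_option[of A B] assms(1-4) by simp
  then have "B \<succeq> sub_waiting (number l) (size B)"
    using GS_lside_Atom_le[OF _ assms(5)] GS_scoring_game
    by (intro game_ge_number_sub_waiting) auto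
  then have "\<exists>n. G \<succeq> sub_waiting (number l) n" using game_ge_trans assms(6) by blast
  then obtain n where "G \<succeq> sub_waiting (number l) n"
    and "\<forall>m. G \<succeq> sub_waiting (number l) m \<longrightarrow> n \<le> m"
    using exists_least_iff[of "\<lambda>n. G \<succeq> sub_waiting (number l) n"] not_less by metis
  moreover from this have
    "G \<sim> Game (Opts (finsert (sub_waiting (number l) (n + 1)) (GL |-| {|A|}))) (rside G)"
    using game_equiv_substitute_atomic_reversible[OF A assms(2) right_nonempty] by blast
  moreover have "G \<sim> Game (Atom l) (rside G)" if "GL = {|A|}"
    using game_equiv_substitute_sole_atomic_reversible[OF A _ right_nonempty] assms(2) that by simp
  ultimately show ?thesis by blast
qed

end
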